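(* Fix an integer $g\ge 2$. The function $s(n)$ satisfies Benford's law in base $g$ with respect to logarithmic density. That is, for each positive integer $D$, the logarithmic density below exists and $$\delta_{\log}\{n>1:\ \text{the leftmost base-}g\text{ digits of } s(n) \text{ are the digits of } D\}=\log_g\left(1+\frac1D\right).$$
   Context: For a positive integer $n$, $s(n)=\sum_{d\mid n,\ d<n} d=\sigma(n)-n$ is the sum of proper divisors of $n$. For $A\subseteq\mathbb{N}$, the logarithmic density is $\delta_{\log}(A)=\lim_{x\to\infty}\frac{1}{\log x}\sum_{n\le x,\ n\in A}\frac1n$, provided the limit exists. The condition that the leftmost base-$g$ digits of $s(n)$ are the digits of $D$ means that the base-$g$ expansion of $s(n)$ begins with the block of base-$g$ digits of $D$, i.e. $D g^{j}\le s(n)<(D+1)g^{j}$ for some integer $j\ge 0$. *)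

theory Defs
  imports Complex_Main
begin

definition aliquot_sum :: "nat \<Rightarrow> nat" where
  "aliquot_sum n = (\<Sum>d | d dvd n \<and> d < n. d)"

(* Existence of the limit is part of the relation. The natural numbers of the source
   start at 1, so a possible element 0 of A is ignored. *)
definition has_log_density :: "nat set \<Rightarrow> real \<Rightarrow> bool" where
  "has_log_density A \<delta> \<longleftrightarrow>
     ((\<lambda>x::real. (1 / ln x) * (\<Sum>n | n \<in> A \<and> 1 \<le> n \<and> real n \<le> x. 1 / real n)) \<longlongrightarrow> \<delta>) at_top"

(* For g \<ge> 2 and D \<ge> 1: m arises from D by appending j further base-g digits,
   that is, m = D * g ^ j + r with 0 \<le> r < g ^ j. *)
definition leftmost_digits :: "nat \<Rightarrow> nat \<Rightarrow> nat \<Rightarrow> bool" where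
  "leftmost_digits g D m \<longleftrightarrow> (\<exists>j::nat. D * g ^ j \<le> m \<and> m < (D + 1) * g ^ j)"

end

(* For n >= 1, s(n) / n is the sum of 1/d over the divisors d > 1 of n. Truncated to d <= K this is
   a function h of n mod K!, and on a residue class, where n * h(n) is a constant multiple of n, the
   logarithmic weight spreads evenly over the base-g scale. The truncation is harmless: the part of
   the sum with d > K has logarithmic mean at most 1/K, and h(n) >= 1/z as soon as n has a divisor
   in [2, z], which fails only on a set of upper logarithmic density at most 1 / (1 + ... + 1/z).
   This bounds the lower density from below, for the digit set and for its complement alike,
   and the two bounds add up to 1. *)

theory Submission
  imports Defs "HOL-Analysis.Harmonic_Numbers"
begin

section \<open>Logarithmic sums and lower logarithmic density\<close>

definition log_sum :: "nat set \<Rightarrow> real \<Rightarrow> real" where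
  "log_sum A x = (\<Sum>n | n \<in> A \<and> 1 \<le> n \<and> real n \<le> x. 1 / real n)"

text \<open>A liminf of \<open>log_sum A x / ln x\<close> in disguise. With the error
  \<open>C\<close> instead of a limit, such bounds can be added term by term, and
  \<open>x = 1\<close>, where \<open>ln x = 0\<close>, is no exception.\<close>

definition lower_log_density_ge :: "nat set \<Rightarrow> real \<Rightarrow> bool" where
  "lower_log_density_ge A \<delta> \<longleftrightarrow>
     (\<forall>\<epsilon>>0. \<exists>C. \<forall>x\<ge>1. log_sum A x \<ge> (\<delta> - \<epsilon>) * ln x - C)"

lemma finite_nat_le_real: "finite {n. P n \<and> 1 \<le> n \<and> real n \<le> x}"
  by (rule finite_subset[of _ "{..nat \<lfloor>x\<rfloor>}"]) (auto simp: le_nat_floor)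

lemma log_sum_nonneg: "0 \<le> log_sum A x"
  unfolding log_sum_def by (rule sum_nonneg) auto

lemma log_sum_mono:
  assumes "\<And>n. n \<in> A \<Longrightarrow> 1 \<le> n \<Longrightarrow> real n \<le> x \<Longrightarrow> n \<in> B"
  shows "log_sum A x \<le> log_sum B x"
  unfolding log_sum_def using assms by (intro sum_mono2 finite_nat_le_real) auto

lemma log_sum_Un_disjoint:
  assumes "A \<inter> B = {}"
  shows "log_sum (A \<union> B) x = log_sum A x + log_sum B x"
proof -
  have "{n. n \<in> A \<union> B \<and> 1 \<le> n \<and> real n \<le> x} =
        {n. n \<in> A \<and> 1 \<le> n \<and> real n \<le> x} \<union> {n. n \<in> B \<and> 1 \<le> n \<and> real n \<le> x}"
    by auto
  then show ?thesis
    unfolding log_sum_def using assms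
    by (simp only:) (rule sum.union_disjoint, use finite_nat_le_real in auto)
qed

lemma log_sum_Un_le: "log_sum (A \<union> B) x \<le> log_sum A x + log_sum B x"
proof -
  have "log_sum (A \<union> B) x = log_sum A x + log_sum (B - A) x"
    using log_sum_Un_disjoint[of A "B - A" x] by auto
  moreover have "log_sum (B - A) x \<le> log_sum B x"
    by (rule log_sum_mono) auto
  ultimately show ?thesis by simp
qed

lemma log_sum_UNIV_le:
  assumes "x \<ge> 1"
  shows "log_sum UNIV x \<le> 1 + ln x"
proof -
  define N where "N = nat \<lfloor>x\<rfloor>"
  have N: "N \<ge> 1" "real N \<le> x"
    using assms by (auto simp: N_def le_nat_iff)
  have eq: "{n. n \<in> UNIV \<and> 1 \<le> n \<and> real n \<le> x} = {1..N}"
    using assms by (auto simp: N_def le_nat_floor le_floor_iff le_nat_iff)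
  have "log_sum UNIV x = harm N"
    unfolding log_sum_def eq harm_def by (simp add: divide_inverse)
  \<comment> \<open>The sequence \<open>harm n - ln n\<close> decreases from its value 1 at
    \<open>n = 1\<close>.\<close>
  also have "\<dots> \<le> 1 + ln (real N)"
    using euler_mascheroni_sequence_decreasing[of 1 N] N by (simp add: harm_def)
  also have "\<dots> \<le> 1 + ln x"
    using N by simp
  finally show ?thesis .
qed

section \<open>Equidistribution over the scales on a residue class\<close>

text \<open>A left Riemann sum with step \<open>M\<close> of the decreasing function
  \<open>1 / t\<close> dominates its integral; in the induction this becomes
  \<open>ln (1 + y) <= y\<close>.\<close>

lemma ln_le_sum_progression:
  fixes a :: real and M J :: nat
  assumes "a > 0"
  shows "ln ((a + real J * real M) / a) \<le> real M * (\<Sum>k<J. 1 / (a + real k * real M))"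
proof (induction J)
  case 0
  then show ?case using assms by simp
next
  case (Suc J)
  define b where "b = a + real J * real M"
  have b: "b > 0" using assms by (simp add: b_def add_pos_nonneg)
  have "ln ((a + real (Suc J) * real M) / a) = ln (b / a) + ln (1 + real M / b)"
  proof -
    have "(a + real (Suc J) * real M) / a = b / a * (1 + real M / b)"
      using assms b by (simp add: field_simps) (simp add: b_def algebra_simps)
    moreover have "ln (b / a * (1 + real M / b)) = ln (b / a) + ln (1 + real M / b)"
      using assms b by (intro ln_mult_pos) (auto intro: add_pos_nonneg)
    ultimately show ?thesis by (simp only:)
  qed
  also have "ln (1 + real M / b) \<le> real M / b"
    using b by (intro ln_add_one_self_le_self) auto
  also have "ln (b / a) \<le> real M * (\<Sum>k<J. 1 / (a + real k * real M))"
    using Suc by (simp add: b_def)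
  finally show ?case by (simp add: b_def algebra_simps)
qed

text \<open>The class is a progression with step \<open>M\<close> that starts before
  \<open>a + M\<close>. The late start costs at most \<open>M / a\<close>, hence
  \<open>1 / a\<close> after division by \<open>M\<close>. The error is explicit because it will be
  summed over all scales.\<close>

lemma sum_residue_class_ge:
  fixes a b :: real and M r :: nat
  assumes "M > 0" "0 < a" "a \<le> b" "r < M"
  shows "(\<Sum>n | n mod M = r \<and> a \<le> real n \<and> real n < b. 1 / real n) \<ge> ln (b / a) / real M - 1 / a"
proof -
  define S where "S = {n. n mod M = r \<and> a \<le> real n \<and> real n < b}"
  have finS: "finite S"
    by (rule finite_subset[of _ "{..nat \<lfloor>b\<rfloor>}"]) (auto simp: S_def intro!: le_nat_floor)
  \<comment> \<open>\<open>n0\<close> is the first member of the class from \<open>a\<close> on;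
    adding \<open>M\<close> first keeps the subtraction from being truncated.\<close>
  define t where "t = nat \<lceil>a\<rceil>"
  define n0 where "n0 = t + (r + M - t mod M) mod M"
  have "n0 mod M = (t mod M + (r + M - t mod M)) mod M"
    unfolding n0_def by (simp add: mod_simps)
  also have "t mod M + (r + M - t mod M) = r + M"
    using assms mod_less_divisor[of M t] by linarith
  finally have n0r: "n0 mod M = r" using assms by simp
  have ta: "a \<le> real t" "real t < a + 1"
    using assms unfolding t_def by linarith+
  have "(r + M - t mod M) mod M \<le> M - 1" using assms
    by (metis Suc_pred' less_Suc_eq_le mod_less_divisor)
  then have n0a: "a \<le> real n0" "real n0 < a + M"
    using ta assms unfolding n0_def by linarith+
  \<comment> \<open>The index at which the progression leaves \<open>[a, b)\<close>; by minimality
    all earlier terms lie below \<open>b\<close>.\<close>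
  define J where "J = (LEAST J. b \<le> real n0 + real J * real M)"
  have "\<exists>J. b \<le> real n0 + real J * real M"
  proof -
    obtain J :: nat where "b / real M \<le> real J" using real_arch_simple by blast
    then have "b \<le> real J * real M" using assms by (simp add: field_simps)
    then show ?thesis by (intro exI[of _ J]) auto
  qed
  then have J1: "b \<le> real n0 + real J * real M"
    unfolding J_def by (rule LeastI_ex)
  have J2: "real n0 + real k * real M < b" if "k < J" for k
    using not_less_Least[of k "\<lambda>J. b \<le> real n0 + real J * real M"] that
    unfolding J_def by auto
  have "ln (b / a) \<le> ln ((real n0 + real J * real M) / real n0) + ln (real n0 / a)"
    using assms n0a J1 by (subst ln_mult_pos[symmetric])
      (auto intro!: divide_right_mono simp: add_pos_nonneg)
  also have "ln (real n0 / a) \<le> real n0 / a - 1"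
    using assms n0a by (intro ln_le_minus_one) auto
  also have "real n0 / a - 1 \<le> real M / a"
    using assms n0a by (simp add: divide_simps)
  also have "ln ((real n0 + real J * real M) / real n0)
               \<le> real M * (\<Sum>k<J. 1 / (real n0 + real k * real M))"
    using assms n0a by (intro ln_le_sum_progression) auto
  also have "(\<Sum>k<J. 1 / (real n0 + real k * real M)) = (\<Sum>n\<in>(\<lambda>k. n0 + k * M) ` {..<J}. 1 / real n)"
    using assms by (subst sum.reindex) (auto simp: inj_on_def)
  also have "\<dots> \<le> (\<Sum>n\<in>S. 1 / real n)"
  proof (rule sum_mono2[OF finS])
    show "(\<lambda>k. n0 + k * M) ` {..<J} \<subseteq> S"
    proof safe
      fix k assume "k < J"
      have "a \<le> real (n0 + k * M)" using n0a by (simp add: add_increasing2)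
      then show "n0 + k * M \<in> S"
        using n0r J2[OF \<open>k < J\<close>] by (auto simp: S_def)
    qed
  qed auto
  finally have "ln (b / a) \<le> real M * (\<Sum>n\<in>S. 1 / real n) + real M / a"
    using assms by simp
  then show ?thesis
    using assms unfolding S_def by (simp add: field_simps)
qed

text \<open>Uniformity in \<open>J\<close> keeps the total error over all scales bounded.\<close>

lemma sum_inverse_powers_le:
  fixes g :: real
  assumes "g \<ge> 2"
  shows "(\<Sum>j<J. 1 / g ^ j) \<le> 2"
proof -
  have "(\<Sum>j<J. 1 / g ^ j) \<le> (\<Sum>j<J. (1 / 2) ^ j)"
    using assms by (intro sum_mono) (auto simp: power_one_over intro!: divide_left_mono power_mono)
  also have "\<dots> = 2 - 2 * (1 / 2) ^ J"
    by (induction J) auto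
  also have "\<dots> \<le> 2" by simp
  finally show ?thesis .
qed

text \<open>The block of each scale \<open>j\<close> has weight \<open>ln (v / u) / M\<close> up to
  an error that decays geometrically in \<open>j\<close>, and about \<open>log g x\<close> blocks
  fit below \<open>x\<close>.\<close>

lemma residue_class_scaled_digits_log_sum:
  fixes g c u v :: real and M r :: nat
  assumes "g \<ge> 2" "M > 0" "r < M" "c > 0" "0 < u" "u \<le> v" "v \<le> u * g"
  shows "\<exists>C. \<forall>x\<ge>1. log_sum {n. n mod M = r \<and> (\<exists>j::nat. u * g ^ j \<le> real n * c \<and> real n * c < v * g ^ j)} x
           \<ge> log g (v / u) / real M * ln x - C"
\<comment> \<open>\<open>C\<close> stays schematic until the final \<open>show\<close>; being
  introduced before \<open>x\<close>, it cannot depend on \<open>x\<close>.\<close>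
proof (intro exI allI impI)
  define S where "S = (\<lambda>j::nat. {n. n mod M = r \<and> u * g ^ j / c \<le> real n \<and> real n < v * g ^ j / c})"
  define A where "A = {n. n mod M = r \<and> (\<exists>j::nat. u * g ^ j \<le> real n * c \<and> real n * c < v * g ^ j)}"
  define L where "L = ln (v / u) / real M"
  fix x :: real assume x: "x \<ge> 1"
  \<comment> \<open>Block \<open>j\<close> ends at \<open>v * g ^ j / c\<close>, which is at most
    \<open>x\<close> iff \<open>j <= log g (x * c / v)\<close>.\<close>
  define J where "J = nat \<lfloor>log g (x * c / v)\<rfloor>"
  have v: "v > 0" and g: "g > 0" "ln g > 0" using assms by auto
  have L: "L \<ge> 0" using assms by (simp add: L_def)
  have Jx: "v * g ^ j / c \<le> x" if "j < J" for j
  proof -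
    have "real j \<le> log g (x * c / v)"
      using that unfolding J_def by linarith
    then have "g powr real j \<le> x * c / v"
      using assms x v by (subst (asm) le_log_iff) auto
    then show ?thesis
      using assms v g by (simp add: powr_realpow field_simps)
  qed
  have finS: "finite (S j)" for j
    by (rule finite_subset[of _ "{..nat \<lfloor>v * g ^ j / c\<rfloor>}"]) (auto simp: S_def intro!: le_nat_floor)
  \<comment> \<open>By \<open>v <= u * g\<close> each block ends no later than the next one
    begins.\<close>
  have disj: "S i \<inter> S j = {}" if "i < j" for i j
  proof -
    have "v * g ^ i \<le> u * g ^ Suc i"
      using assms g by (simp add: mult.assoc[symmetric] mult_right_mono)
    also have "\<dots> \<le> u * g ^ j"
      using assms that by (intro mult_left_mono power_increasing) auto
    finally have "v * g ^ i / c \<le> u * g ^ j / c"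
      using assms by (intro divide_right_mono) auto
    then show ?thesis by (auto simp: S_def)
  qed
  have disj: "S i \<inter> S j = {}" if "i \<noteq> j" for i j
    using disj[of i j] disj[of j i] that by (cases "i < j") auto
  \<comment> \<open>This also holds for a negative logarithm, where \<open>nat\<close> gives
    \<open>J = 0\<close>.\<close>
  have "real J \<ge> log g (x * c / v) - 1"
    unfolding J_def by linarith
  also have "log g (x * c / v) = (ln x + ln (c / v)) / ln g"
    using assms x v by (simp add: log_def ln_mult_pos ln_div)
  finally have "L * ((ln x + ln (c / v)) / ln g - 1) \<le> real J * L"
    using L by (simp add: mult.commute[of "real J"] mult_left_mono)
  moreover have "(\<Sum>j<J. c / (u * g ^ j)) \<le> 2 * c / u"
  proof -
    have "(\<Sum>j<J. c / (u * g ^ j)) = c / u * (\<Sum>j<J. 1 / g ^ j)"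
      by (simp add: sum_distrib_left)
    also have "\<dots> \<le> c / u * 2"
      using assms by (intro mult_left_mono sum_inverse_powers_le) auto
    finally show ?thesis by (simp add: mult.commute)
  qed
  moreover have "real J * L - (\<Sum>j<J. c / (u * g ^ j)) \<le> log_sum A x"
  proof -
    have "real J * L - (\<Sum>j<J. c / (u * g ^ j)) = (\<Sum>j<J. L - c / (u * g ^ j))"
      by (simp add: sum_subtractf)
    also have "\<dots> \<le> (\<Sum>j<J. \<Sum>n\<in>S j. 1 / real n)"
    proof (rule sum_mono)
      fix j
      have "ln ((v * g ^ j / c) / (u * g ^ j / c)) / real M - 1 / (u * g ^ j / c) \<le> (\<Sum>n\<in>S j. 1 / real n)"
        unfolding S_def using assms(2-6) g
        by (intro sum_residue_class_ge divide_right_mono mult_right_mono divide_pos_pos mult_pos_pos) auto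
      moreover have "(v * g ^ j / c) / (u * g ^ j / c) = v / u"
        using \<open>c > 0\<close> g by simp
      ultimately show "L - c / (u * g ^ j) \<le> (\<Sum>n\<in>S j. 1 / real n)"
        by (simp add: L_def)
    qed
    also have "\<dots> = (\<Sum>n\<in>(\<Union>j<J. S j). 1 / real n)"
      using finS disj by (intro sum.UNION_disjoint[symmetric]) auto
    also have "\<dots> \<le> log_sum A x"
      unfolding log_sum_def
    proof (intro sum_mono2 finite_nat_le_real subsetI)
      fix n assume "n \<in> (\<Union>j<J. S j)"
      then obtain j where j: "j < J" and n: "n \<in> S j" by auto
      have "0 < u * g ^ j / c" using assms by auto
      then have "n \<ge> 1" using n by (cases n) (auto simp: S_def)
      moreover have "real n \<le> x" using Jx[OF j] n by (auto simp: S_def)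
      moreover have "n \<in> A"
        using n \<open>c > 0\<close> by (auto simp: S_def A_def pos_divide_le_eq pos_less_divide_eq)
      ultimately show "n \<in> {n. n \<in> A \<and> 1 \<le> n \<and> real n \<le> x}" by simp
    qed auto
    finally show ?thesis .
  qed
  ultimately have "L * ((ln x + ln (c / v)) / ln g - 1) - 2 * c / u \<le> log_sum A x"
    by linarith
  moreover have "L * ((ln x + ln (c / v)) / ln g - 1)
      = log g (v / u) / real M * ln x - L * (1 - ln (c / v) / ln g)"
    using g by (simp add: L_def log_def diff_divide_distrib add_divide_distrib ring_distribs)
  ultimately show "log_sum {n. n mod M = r \<and> (\<exists>j::nat. u * g ^ j \<le> real n * c \<and> real n * c < v * g ^ j)} x
      \<ge> log g (v / u) / real M * ln x
          - (ln (v / u) / real M * (1 - ln (c / v) / ln g) + 2 * c / u)"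
    by (simp add: A_def L_def)
qed

lemma log_sum_residue_classes:
  assumes "M > 0"
  shows "log_sum A x = (\<Sum>r<M. log_sum {n \<in> A. n mod M = r} x)"
proof -
  have "{n. n \<in> A \<and> 1 \<le> n \<and> real n \<le> x}
      = (\<Union>r<M. {n. n \<in> {n \<in> A. n mod M = r} \<and> 1 \<le> n \<and> real n \<le> x})"
    using assms by auto
  moreover have "sum f (\<Union>r<M. {n. n \<in> {n \<in> A. n mod M = r} \<and> 1 \<le> n \<and> real n \<le> x})
      = (\<Sum>r<M. sum f {n. n \<in> {n \<in> A. n mod M = r} \<and> 1 \<le> n \<and> real n \<le> x})" for f :: "nat \<Rightarrow> real"
    by (intro sum.UNION_disjoint ballI finite_nat_le_real) auto
  ultimately show ?thesis
    unfolding log_sum_def by (simp only:)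
qed

text \<open>On each residue class \<open>c\<close> is constant, and the \<open>M\<close> main terms,
  each with weight \<open>1 / M\<close>, add up to one that depends neither on \<open>M\<close> nor
  on \<open>c\<close>.\<close>

lemma periodic_scaled_digits_log_sum:
  fixes g u v :: real and c :: "nat \<Rightarrow> real"
  assumes "g \<ge> 2" "M > 0" "\<And>n. c n > 0" "\<And>n. c (n mod M) = c n" "0 < u" "u \<le> v" "v \<le> u * g"
  shows "\<exists>C. \<forall>x\<ge>1. log_sum {n. \<exists>j::nat. u * g ^ j \<le> real n * c n \<and> real n * c n < v * g ^ j} x
           \<ge> log g (v / u) * ln x - C"
proof -
  define B where "B = (\<lambda>r. {n. n mod M = r \<and> (\<exists>j::nat. u * g ^ j \<le> real n * c r \<and> real n * c r < v * g ^ j)})"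
  define A where "A = {n. \<exists>j::nat. u * g ^ j \<le> real n * c n \<and> real n * c n < v * g ^ j}"
  have "\<exists>C. \<forall>x\<ge>1. log_sum (B r) x \<ge> log g (v / u) / real M * ln x - C" if "r < M" for r
    unfolding B_def using assms that by (intro residue_class_scaled_digits_log_sum) auto
  then have "\<forall>r\<in>{..<M}. \<exists>C. \<forall>x\<ge>1. log_sum (B r) x \<ge> log g (v / u) / real M * ln x - C"
    by auto
  from bchoice[OF this] obtain C where
    C: "\<And>r x. r < M \<Longrightarrow> x \<ge> 1 \<Longrightarrow> log_sum (B r) x \<ge> log g (v / u) / real M * ln x - C r"
    by auto
  have "log g (v / u) * ln x - (\<Sum>r<M. C r) \<le> log_sum A x" if "x \<ge> 1" for x
  proof -
    have "log g (v / u) * ln x - (\<Sum>r<M. C r) = (\<Sum>r<M. log g (v / u) / real M * ln x - C r)"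
      using assms by (simp add: sum_subtractf)
    also have "\<dots> \<le> (\<Sum>r<M. log_sum (B r) x)"
      using C that by (intro sum_mono) auto
    also have "\<dots> = (\<Sum>r<M. log_sum {n \<in> A. n mod M = r} x)"
    proof (intro sum.cong refl arg_cong[where f = "\<lambda>S. log_sum S x"])
      fix r
      show "B r = {n \<in> A. n mod M = r}"
      proof (rule set_eqI)
        fix n show "n \<in> B r \<longleftrightarrow> n \<in> {n \<in> A. n mod M = r}"
          using assms(4)[of n] by (cases "n mod M = r") (auto simp: B_def A_def)
      qed
    qed
    also have "\<dots> = log_sum A x"
      using assms by (intro log_sum_residue_classes[symmetric])
    finally show ?thesis .
  qed
  then show ?thesis unfolding A_def by blast
qed

section \<open>Integers without small divisors\<close>

text \<open>Products of some \<open>m \<le> z\<close> and some \<open>n\<close> without divisors in \<open>[2, z]\<close> determine both factors,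
  as \<open>m\<close> is coprime to every such \<open>n\<close>; this replaces Mertens' theorem.\<close>

lemma log_sum_rough_le:
  assumes "x \<ge> 1" "z \<ge> 1"
  shows "log_sum {n. \<forall>d\<in>{2..z}. \<not> d dvd n} x \<le> (1 + ln x + ln (real z)) / harm z"
proof -
  define R where "R = {n. n \<in> {n. \<forall>d\<in>{2..z}. \<not> d dvd n} \<and> 1 \<le> n \<and> real n \<le> x}"
  have cop: "coprime m n" if "m \<in> {1..z}" "n \<in> R" for m n
  proof -
    \<comment> \<open>The gcd divides \<open>n\<close> and is at most \<open>z\<close>, so it cannot
      lie in \<open>[2, z]\<close>.\<close>
    have "gcd m n \<le> m" using that by (intro gcd_le1_nat) auto
    then have "gcd m n \<le> z" using that(1) unfolding atLeastAtMost_iff by linarith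
    moreover have "\<forall>d\<in>{2..z}. \<not> d dvd n" using that(2) by (simp add: R_def)
    ultimately have "\<not> 2 \<le> gcd m n" by (meson atLeastAtMost_iff gcd_dvd2)
    moreover have "gcd m n \<noteq> 0" using that(1) by simp
    ultimately have "gcd m n = 1" by linarith
    then show ?thesis by (simp add: coprime_iff_gcd_eq_1)
  qed
  have inj: "inj_on (\<lambda>(m, n). m * n) ({1..z} \<times> R)"
  proof (rule inj_onI, safe)
    fix m n m' n' assume *: "m \<in> {1..z}" "n \<in> R" "m' \<in> {1..z}" "n' \<in> R" "m * n = m' * n'"
    have "m dvd m'" 
      using cop[of m n'] coprime_dvd_mult_left_iff[of m n' m'] *(1,4) *(5)[symmetric] by simp
    moreover have "m' dvd m" 
      using cop[of m' n] coprime_dvd_mult_left_iff[of m' n m] *(2,3,5) by simp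
    ultimately show "m = m'" by (rule dvd_antisym)
    then show "n = n'" using * by auto
  qed
  \<comment> \<open>The product of the two sums runs over pairs; by injectivity it is a sum over
    distinct integers up to \<open>z * x\<close>.\<close>
  have "harm z * log_sum {n. \<forall>d\<in>{2..z}. \<not> d dvd n} x = (\<Sum>m\<in>{1..z}. \<Sum>n\<in>R. 1 / real (m * n))"
    by (simp add: harm_def log_sum_def R_def sum_product divide_inverse)
  also have "\<dots> = (\<Sum>k\<in>(\<lambda>(m, n). m * n) ` ({1..z} \<times> R). 1 / real k)"
    by (subst sum.reindex[OF inj]) (simp add: sum.cartesian_product case_prod_unfold)
  also have "\<dots> \<le> log_sum UNIV (real z * x)"
    unfolding log_sum_def
  proof (intro sum_mono2 finite_nat_le_real subsetI)
    fix k assume "k \<in> (\<lambda>(m, n). m * n) ` ({1..z} \<times> R)"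
    then obtain m n where mn: "k = m * n" "m \<in> {1..z}" "n \<in> R" by auto
    then have "real m * real n \<le> real z * x"
      by (intro mult_mono) (auto simp: R_def)
    then show "k \<in> {n. n \<in> UNIV \<and> 1 \<le> n \<and> real n \<le> real z * x}"
      using mn by (auto simp: R_def)
  qed auto
  also have "\<dots> \<le> 1 + ln (real z * x)"
    using assms mult_mono[of 1 "real z" 1 x] by (intro log_sum_UNIV_le) auto
  also have "\<dots> = 1 + ln x + ln (real z)"
    using assms by (simp add: ln_mult_pos)
  finally show ?thesis
    using assms harm_pos[of z, where 'a = real] by (simp add: field_simps)
qed

section \<open>Head and tail of s(n) / n\<close>

text \<open>At \<open>n = 0\<close> the tail is a sum over an infinite set, hence 0.\<close>

definition abundance_head :: "nat \<Rightarrow> nat \<Rightarrow> real" where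
  "abundance_head K n = (\<Sum>d | d dvd n \<and> 1 < d \<and> d \<le> K. 1 / real d)"

definition abundance_tail :: "nat \<Rightarrow> nat \<Rightarrow> real" where
  "abundance_tail K n = (\<Sum>d | d dvd n \<and> K < d. 1 / real d)"

text \<open>Passing from a proper divisor to its codivisor \<open>n div d\<close> gives the divisors
  above 1, which are then split at \<open>K\<close>.\<close>

lemma aliquot_sum_eq_head_tail:
  assumes "n \<ge> 1" "K \<ge> 1"
  shows "real (aliquot_sum n) = real n * (abundance_head K n + abundance_tail K n)"
proof -
  have fin: "finite {d. d dvd n \<and> P d}" for P
    using assms by (intro finite_subset[OF _ finite_divisors_nat[of n]]) auto
  have "real (aliquot_sum n) = (\<Sum>d | d dvd n \<and> d < n. real d)"
    by (simp add: aliquot_sum_def)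
  also have "\<dots> = (\<Sum>d | d dvd n \<and> 1 < d. real n * (1 / real d))"
    using assms
    by (intro sum.reindex_bij_witness[of _ "\<lambda>d. n div d" "\<lambda>d. n div d"])
       (auto elim!: dvdE)
  also have "{d. d dvd n \<and> 1 < d} = {d. d dvd n \<and> 1 < d \<and> d \<le> K} \<union> {d. d dvd n \<and> K < d}"
    using assms by auto
  also have "(\<Sum>d\<in>\<dots>. real n * (1 / real d)) = real n * (abundance_head K n + abundance_tail K n)"
    unfolding abundance_head_def abundance_tail_def distrib_left sum_distrib_left
    by (rule sum.union_disjoint) (auto simp: fin)
  finally show ?thesis .
qed

text \<open>Every \<open>d <= K\<close> divides \<open>K!\<close>, so reduction modulo
  \<open>K!\<close> does not affect divisibility by \<open>d\<close>.\<close>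

lemma abundance_head_mod_fact: "abundance_head K (n mod fact K) = abundance_head K n"
proof -
  have "d dvd n mod fact K \<longleftrightarrow> d dvd n" if "1 < d" "d \<le> K" for d
    using that by (intro dvd_mod_iff dvd_fact) auto
  then have "{d. d dvd n mod fact K \<and> 1 < d \<and> d \<le> K} = {d. d dvd n \<and> 1 < d \<and> d \<le> K}"
    by auto
  then show ?thesis by (simp add: abundance_head_def)
qed

lemma abundance_head_nonneg: "abundance_head K n \<ge> 0"
  unfolding abundance_head_def by (rule sum_nonneg) auto

lemma abundance_tail_nonneg: "abundance_tail K n \<ge> 0"
  unfolding abundance_tail_def by (rule sum_nonneg) auto

text \<open>A single small divisor suffices. The bound is free of \<open>K\<close>, so
  \<open>K\<close> can be chosen after \<open>z\<close>.\<close>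

lemma abundance_head_ge:
  assumes "d dvd n" "2 \<le> d" "d \<le> z" "z \<le> K"
  shows "abundance_head K n \<ge> 1 / real z"
proof -
  have "1 / real z \<le> 1 / real d"
    using assms by (intro divide_left_mono) auto
  also have "\<dots> \<le> abundance_head K n"
    unfolding abundance_head_def
    by (rule member_le_sum) (use assms in \<open>auto intro: finite_subset[of _ "{..K}"]\<close>)
  finally show ?thesis .
qed

text \<open>Telescoping with \<open>1 / (N + 1)^2 <= 1 / N - 1 / (N + 1)\<close>.\<close>

lemma sum_inverse_squares_le:
  assumes "K \<ge> 1"
  shows "(\<Sum>d\<in>{K<..N}. 1 / real d ^ 2) \<le> 1 / real K"
proof (cases "K \<le> N")
  case True
  then have "(\<Sum>d\<in>{K<..N}. 1 / real d ^ 2) \<le> 1 / real K - 1 / real N"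
  proof (induction N rule: dec_induct)
    case (step N)
    have "{K<..Suc N} = insert (Suc N) {K<..N}" using step by auto
    moreover have "1 / real (Suc N) ^ 2 \<le> 1 / real N - 1 / real (Suc N)"
    proof -
      have "1 / real N - 1 / real (Suc N) = 1 / (real N * real (Suc N))"
        using assms step by (simp add: field_simps)
      moreover have "1 / real (Suc N) ^ 2 \<le> 1 / (real N * real (Suc N))"
        using assms step by (intro divide_left_mono) (auto simp: power2_eq_square)
      ultimately show ?thesis by simp
    qed
    ultimately show ?case using step by simp
  qed simp
  also have "\<dots> \<le> 1 / real K" by simp
  finally show ?thesis .
qed simp

text \<open>Markov's inequality for the logarithmic mean of the tail: with \<open>n = d * m\<close>
  that mean splits into a sum of \<open>1 / d^2\<close> over \<open>d > K\<close> and a sum of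
  \<open>1 / m\<close>.\<close>

lemma log_sum_tail_le:
  assumes "K \<ge> 1" "\<tau> > 0" "x \<ge> 1"
  shows "log_sum {n. abundance_tail K n > \<tau>} x \<le> (1 + ln x) / (real K * \<tau>)"
proof -
  define N where "N = {n::nat. n \<in> UNIV \<and> 1 \<le> n \<and> real n \<le> x}"
  define P where "P = (SIGMA n:N. {d. d dvd n \<and> K < d})"
  define b where "b = nat \<lfloor>x\<rfloor>"
  have finN: "finite N" unfolding N_def by (rule finite_nat_le_real)
  have fin: "finite {d. d dvd n \<and> K < d}" if "n \<in> N" for n
    using that by (intro finite_subset[OF _ finite_divisors_nat[of n]]) (auto simp: N_def)
  have "\<tau> * log_sum {n. abundance_tail K n > \<tau>} x
      = (\<Sum>n | n \<in> {n. abundance_tail K n > \<tau>} \<and> 1 \<le> n \<and> real n \<le> x. 1 / real n * \<tau>)"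
    by (simp add: log_sum_def sum_distrib_left)
  also have "\<dots> \<le> (\<Sum>n | n \<in> {n. abundance_tail K n > \<tau>} \<and> 1 \<le> n \<and> real n \<le> x. 1 / real n * abundance_tail K n)"
    by (intro sum_mono mult_left_mono) auto
  also have "\<dots> \<le> (\<Sum>n\<in>N. 1 / real n * abundance_tail K n)"
    using finN abundance_tail_nonneg by (intro sum_mono2) (auto simp: N_def)
  also have "\<dots> = (\<Sum>(n, d)\<in>P. 1 / real n * (1 / real d))"
    unfolding P_def using finN fin
    by (simp add: sum.Sigma[symmetric] abundance_tail_def sum_distrib_left)
  also have "\<dots> \<le> (\<Sum>(d, m)\<in>{K<..b} \<times> N. 1 / real d ^ 2 * (1 / real m))"
  \<comment> \<open>The pair \<open>(d, m)\<close> stands for \<open>n = d * m\<close> with its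
    divisor \<open>d\<close>. Letting \<open>m\<close> run up to \<open>x\<close> instead of
    \<open>x / d\<close> only adds nonnegative terms and makes the sum a product.\<close>
  proof (rule sum_le_included[where i = "\<lambda>(d, m). (d * m, d)"])
    show "finite P" unfolding P_def using finN fin by auto
    show "finite ({K<..b} \<times> N)" using finN by simp
    show "\<forall>p\<in>P. \<exists>q\<in>{K<..b} \<times> N. (case q of (d, m) \<Rightarrow> (d * m, d)) = p \<and>
        (case p of (n, d) \<Rightarrow> 1 / real n * (1 / real d)) \<le> (case q of (d, m) \<Rightarrow> 1 / real d ^ 2 * (1 / real m))"
    proof
      fix p assume p: "p \<in> P"
      obtain n d where nd: "p = (n, d)" by (cases p)
      obtain m where m: "n = d * m" "K < d" "1 \<le> n" "real n \<le> x"
        using p by (auto simp: nd P_def N_def elim!: dvdE)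
      then have "d \<le> n" "m \<le> n" "m \<ge> 1" "d \<ge> 1" by auto
      then have "real d \<le> x" "real m \<le> x" using m(4) by linarith+
      then have "(d, m) \<in> {K<..b} \<times> N"
        using m(2) \<open>m \<ge> 1\<close> by (auto simp: N_def b_def le_nat_floor)
      moreover have "1 / real n * (1 / real d) = 1 / real d ^ 2 * (1 / real m)"
        using m(1) by (simp add: power2_eq_square)
      ultimately show "\<exists>q\<in>{K<..b} \<times> N. (case q of (d, m) \<Rightarrow> (d * m, d)) = p \<and>
        (case p of (n, d) \<Rightarrow> 1 / real n * (1 / real d)) \<le> (case q of (d, m) \<Rightarrow> 1 / real d ^ 2 * (1 / real m))"
        using m(1) nd by (intro bexI[of _ "(d, m)"]) (simp_all only: prod.case simp_thms order_refl)
    qed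
  qed auto
  also have "\<dots> = (\<Sum>d\<in>{K<..b}. 1 / real d ^ 2) * log_sum UNIV x"
    by (simp only: log_sum_def N_def[symmetric] sum_product sum.cartesian_product)
  also have "\<dots> \<le> 1 / real K * (1 + ln x)"
    using assms by (intro mult_mono sum_inverse_squares_le log_sum_UNIV_le log_sum_nonneg) auto
  finally show ?thesis
    using assms by (simp add: field_simps)
qed

text \<open>The head is at least \<open>1 / z\<close>, so a tail of at most
  \<open>\<eta> / z\<close> is a relative error of at most \<eta>.\<close>

lemma abundance_dominated_by_head:
  assumes "n \<ge> 1" "d dvd n" "2 \<le> d" "d \<le> z" "z \<le> K"
    and "abundance_tail K n \<le> \<eta> / real z" "\<eta> \<ge> 0"
  shows "real n * abundance_head K n \<le> real (aliquot_sum n)"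
    and "real (aliquot_sum n) \<le> real n * abundance_head K n * (1 + \<eta>)"
proof -
  have eq: "real (aliquot_sum n) = real n * (abundance_head K n + abundance_tail K n)"
    using assms by (intro aliquot_sum_eq_head_tail) auto
  show "real n * abundance_head K n \<le> real (aliquot_sum n)"
    unfolding eq using abundance_tail_nonneg by (intro mult_left_mono) auto
  have "\<eta> * (1 / real z) \<le> \<eta> * abundance_head K n"
    using assms abundance_head_ge[of d n z K] by (intro mult_left_mono) auto
  then have "abundance_head K n + abundance_tail K n \<le> abundance_head K n * (1 + \<eta>)"
    using assms by (simp add: algebra_simps)
  then show "real (aliquot_sum n) \<le> real n * abundance_head K n * (1 + \<eta>)"
    unfolding eq mult.assoc by (intro mult_left_mono) auto
qed

section \<open>Lower density of the digit sets of s(n)\<close>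

text \<open>The head is placed in a window shrunk only at its upper end, since s(n) can only exceed
  its head part. The shrinking and the exceptional sets \<open>R\<close> and \<open>T\<close> cost
  \<open>\<epsilon> / 3\<close> each.\<close>

lemma aliquot_sum_digits_lower_density:
  fixes g u v :: real
  assumes "g \<ge> 2" "0 < u" "u \<le> v" "v \<le> u * g"
  shows "lower_log_density_ge
           {n. \<exists>j::nat. u * g ^ j \<le> real (aliquot_sum n) \<and> real (aliquot_sum n) < v * g ^ j} (log g (v / u))"
    (is "lower_log_density_ge ?A _")
  unfolding lower_log_density_ge_def
proof (intro allI impI)
  fix \<epsilon> :: real assume \<epsilon>: "\<epsilon> > 0"
  show "\<exists>C. \<forall>x\<ge>1. log_sum ?A x \<ge> (log g (v / u) - \<epsilon>) * ln x - C"
  proof (cases "u = v")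
    \<comment> \<open>The window is empty and leaves no room for shrinking, but the main term is
      \<open>log g 1 = 0\<close>.\<close>
    case True
    have "(log g (v / u) - \<epsilon>) * ln x - 0 \<le> log_sum ?A x" if "x \<ge> 1" for x
    proof -
      have "(log g (v / u) - \<epsilon>) * ln x \<le> 0"
        using True assms \<epsilon> that by (simp add: mult_nonpos_nonneg)
      then show ?thesis using log_sum_nonneg[of ?A x] by simp
    qed
    then show ?thesis by blast
  next
    case False
    \<comment> \<open>The first bound limits the loss in \<open>log g (v / u)\<close> to
      \<open>\<epsilon> / 3\<close>; the second ensures \<open>u <= w\<close>.\<close>
    define \<eta> where "\<eta> = min (g powr (\<epsilon> / 3)) (v / u) - 1"
    have "g powr (\<epsilon> / 3) > 1" using assms \<epsilon> by (intro gr_one_powr) auto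
    moreover have "v / u > 1" using assms False by simp
    ultimately have \<eta>: "\<eta> > 0" by (simp add: \<eta>_def)
    have \<eta>1: "1 + \<eta> \<le> g powr (\<epsilon> / 3)" "1 + \<eta> \<le> v / u" by (auto simp: \<eta>_def)
    have "log g (1 + \<eta>) \<le> log g (g powr (\<epsilon> / 3))"
      using \<eta>1(1) \<eta> assms by (intro log_mono) auto
    then have log\<eta>: "log g (1 + \<eta>) \<le> \<epsilon> / 3" using assms by simp
    define w where "w = v / (1 + \<eta>)"
    have w: "u \<le> w" "w \<le> u * g"
    proof -
      show "u \<le> w" using \<eta>1(2) \<eta> assms by (simp add: w_def field_simps)
      have "w \<le> v" using \<eta> assms by (simp add: w_def field_simps)
      then show "w \<le> u * g" using assms by simp
    qed
    have "log g (w / u) = log g ((v / u) / (1 + \<eta>))" by (simp add: w_def mult.commute)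
    also have "\<dots> = log g (v / u) - log g (1 + \<eta>)"
      by (rule log_divide_pos) (use assms \<eta> in auto)
    finally have logw: "log g (w / u) \<ge> log g (v / u) - \<epsilon> / 3"
      using log\<eta> by linarith
    \<comment> \<open>Divergence of the harmonic series makes the rough numbers \<open>R\<close>
      rare; \<tau> and then \<open>K\<close> are chosen depending on this \<open>z\<close>.\<close>
    obtain z :: nat where z: "z \<ge> 1" "3 / \<epsilon> \<le> harm z"
    proof -
      have "\<forall>\<^sub>F z in sequentially. 3 / \<epsilon> \<le> harm z \<and> z \<ge> 1"
        using harm_at_top eventually_ge_at_top[of "1::nat"]
        unfolding filterlim_at_top by (auto intro: eventually_conj)
      then show ?thesis using that by (auto simp: eventually_sequentially)
    qed
    define \<tau> where "\<tau> = \<eta> / real z"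
    have \<tau>: "\<tau> > 0" using \<eta> z by (simp add: \<tau>_def)
    \<comment> \<open>This makes the density bound \<open>1 / (K * \<tau>)\<close> for
      \<open>T\<close> at most \<open>\<epsilon> / 3\<close>; the maximum with \<open>z\<close> lets
      the head see all divisors up to \<open>z\<close>.\<close>
    obtain K0 :: nat where K0: "3 / (\<epsilon> * \<tau>) \<le> real K0" using real_arch_simple by blast
    define K where "K = max K0 z"
    have K: "z \<le> K" "K \<ge> 1" "3 / (\<epsilon> * \<tau>) \<le> real K"
      using K0 z by (auto simp: K_def)
    \<comment> \<open>The value 1 is a dummy that keeps \<open>c\<close> positive; it occurs only on \<open>R\<close>.\<close>
    define c where "c = (\<lambda>n. if abundance_head K n = 0 then 1 else abundance_head K n)"
    define S where "S = {n. \<exists>j::nat. u * g ^ j \<le> real n * c n \<and> real n * c n < w * g ^ j}"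
    define R where "R = {n. \<forall>d\<in>{2..z}. \<not> d dvd n}"
    define T where "T = {n. abundance_tail K n > \<tau>}"
    have "\<exists>C. \<forall>x\<ge>1. log_sum S x \<ge> log g (w / u) * ln x - C"
      unfolding S_def
    proof (rule periodic_scaled_digits_log_sum[where M = "fact K"])
      show "c n > 0" for n
        using abundance_head_nonneg[of K n] by (auto simp: c_def)
      show "c (n mod fact K) = c n" for n
        by (simp add: c_def abundance_head_mod_fact)
    qed (use assms w in auto)
    then obtain C where C: "\<And>x. x \<ge> 1 \<Longrightarrow> log_sum S x \<ge> log g (w / u) * ln x - C" by blast
    \<comment> \<open>Outside \<open>R\<close> there is a divisor in \<open>[2, z]\<close>, outside
      \<open>T\<close> the tail is at most \<open>\<eta> / z\<close>; so passing from the head to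
      s(n) multiplies by a factor between 1 and \<open>1 + \<eta> = v / w\<close>.\<close>
    have sub: "n \<in> ?A \<union> (R \<union> T)" if "n \<in> S" "1 \<le> n" for n
    proof (rule ccontr)
      assume "n \<notin> ?A \<union> (R \<union> T)"
      then have n: "n \<notin> ?A" "n \<notin> R" "n \<notin> T" by auto
      obtain d where d: "d dvd n" "2 \<le> d" "d \<le> z" using n(2) by (auto simp: R_def)
      have tail: "abundance_tail K n \<le> \<eta> / real z" using n(3) by (auto simp: T_def \<tau>_def)
      have "1 / real z > 0" using z by simp
      then have "c n = abundance_head K n"
        using abundance_head_ge[OF d K(1)] by (auto simp: c_def)
      with that obtain j :: nat where j: "u * g ^ j \<le> real n * abundance_head K n"
        "real n * abundance_head K n < w * g ^ j" by (auto simp: S_def)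
      note ab = abundance_dominated_by_head[OF that(2) d K(1) tail]
      have "real (aliquot_sum n) \<le> real n * abundance_head K n * (1 + \<eta>)"
        using ab(2) \<eta> by simp
      also have "\<dots> < w * g ^ j * (1 + \<eta>)"
        using j(2) \<eta> by (intro mult_strict_right_mono) auto
      also have "\<dots> = v * g ^ j" using \<eta> by (simp add: w_def)
      finally have "real (aliquot_sum n) < v * g ^ j" .
      moreover have "u * g ^ j \<le> real (aliquot_sum n)"
        using j(1) ab(1) \<eta> by simp
      ultimately show False using n(1) by blast
    qed
    \<comment> \<open>The constant collects \<open>C\<close> from \<open>S\<close> and the parts of
      the bounds for \<open>R\<close> and \<open>T\<close> that are free of
      \<open>x\<close>.\<close>
    have "(log g (v / u) - \<epsilon>) * ln x - (C + \<epsilon> / 3 * (1 + ln (real z)) + \<epsilon> / 3) \<le> log_sum ?A x"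
      if x: "x \<ge> 1" for x
    proof -
      have "log_sum S x \<le> log_sum (?A \<union> (R \<union> T)) x"
        using sub by (rule log_sum_mono)
      also have "\<dots> \<le> log_sum ?A x + (log_sum R x + log_sum T x)"
        using log_sum_Un_le[of ?A "R \<union> T" x] log_sum_Un_le[of R T x] by linarith
      finally have "log_sum S x \<le> log_sum ?A x + (log_sum R x + log_sum T x)" .
      moreover have "log_sum R x \<le> \<epsilon> / 3 * (1 + ln x + ln (real z))"
      proof -
        have "log_sum R x \<le> (1 + ln x + ln (real z)) / harm z"
          unfolding R_def using x z by (intro log_sum_rough_le) auto
        also have "\<dots> \<le> (1 + ln x + ln (real z)) / (3 / \<epsilon>)"
          using x z \<epsilon> by (intro divide_left_mono) (auto intro!: add_nonneg_nonneg mult_pos_pos harm_pos)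
        finally show ?thesis by (simp add: field_simps)
      qed
      moreover have "log_sum T x \<le> \<epsilon> / 3 * (1 + ln x)"
      proof -
        have "log_sum T x \<le> (1 + ln x) / (real K * \<tau>)"
          unfolding T_def using x K \<tau> by (intro log_sum_tail_le) auto
        also have "\<dots> \<le> (1 + ln x) / (3 / \<epsilon>)"
        proof (rule divide_left_mono)
          show "3 / \<epsilon> \<le> real K * \<tau>" using K(3) \<epsilon> \<tau> by (simp add: field_simps)
        qed (use x \<epsilon> K \<tau> in auto)
        finally show ?thesis by (simp add: field_simps)
      qed
      moreover have "(log g (v / u) - \<epsilon> / 3) * ln x \<le> log g (w / u) * ln x"
        using logw x by (intro mult_right_mono) auto
      ultimately show ?thesis
        using C[OF x] by (simp add: algebra_simps add_divide_distrib)
    qed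
    then show ?thesis by blast
  qed
qed

section \<open>From lower densities to the density\<close>

text \<open>By disjointness the two sums total at most \<open>1 + ln x\<close>, so the lower bound
  for \<open>B\<close> is an upper bound for \<open>A\<close>.\<close>

lemma has_log_density_of_lower_densities:
  assumes "lower_log_density_ge A \<delta>" "lower_log_density_ge B (1 - \<delta>)" "A \<inter> B = {}"
  shows "has_log_density A \<delta>"
  unfolding has_log_density_def log_sum_def[symmetric]
proof (rule tendstoI)
  fix e :: real assume e: "e > 0"
  obtain C where C: "\<And>x. x \<ge> 1 \<Longrightarrow> log_sum A x \<ge> (\<delta> - e / 2) * ln x - C"
    using assms(1) e unfolding lower_log_density_ge_def by (meson half_gt_zero)
  obtain C' where C': "\<And>x. x \<ge> 1 \<Longrightarrow> log_sum B x \<ge> (1 - \<delta> - e / 2) * ln x - C'"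
    using assms(2) e unfolding lower_log_density_ge_def by (meson half_gt_zero)
  \<comment> \<open>Covers the error \<open>C\<close> of the lower bound and the error
    \<open>1 + C'\<close> of the upper bound.\<close>
  define D where "D = max C (1 + C')"
  have "filterlim (ln :: real \<Rightarrow> real) at_top at_top" by (rule ln_at_top)
  \<comment> \<open>The threshold \<open>2 * D / e\<close> gives \<open>D < e / 2 * ln x\<close>;
    the 1 keeps \<open>ln x\<close> positive.\<close>
  then have "\<forall>\<^sub>F x in at_top. ln x > max 1 (2 * D / e)"
    unfolding filterlim_at_top_dense by blast
  with eventually_ge_at_top[of "1::real"]
  show "\<forall>\<^sub>F x in at_top. dist (1 / ln x * log_sum A x) \<delta> < e"
  proof eventually_elim
    case (elim x)
    have lnx: "ln x > 0"
      using elim by linarith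
    have "2 * D / e < ln x"
      using elim by simp
    then have D: "D < e / 2 * ln x"
      using e by (simp add: field_simps)
    have "log_sum A x + log_sum B x \<le> 1 + ln x"
      using log_sum_Un_disjoint[OF assms(3), of x] log_sum_mono[of "A \<union> B" x UNIV]
        log_sum_UNIV_le[of x] elim by auto
    then have "log_sum A x \<le> (\<delta> + e / 2) * ln x + D"
      using C'[of x] elim by (simp add: D_def algebra_simps)
    moreover have "log_sum A x \<ge> (\<delta> - e / 2) * ln x - D"
      using C[of x] elim by (simp add: D_def)
    ultimately have "\<bar>log_sum A x - \<delta> * ln x\<bar> < e * ln x"
      using D by (simp add: algebra_simps abs_less_iff)
    moreover have "1 / ln x * log_sum A x - \<delta> = (log_sum A x - \<delta> * ln x) / ln x"
      using lnx by (simp add: field_simps)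
    ultimately show ?case
      using lnx by (simp add: dist_real_def pos_divide_less_eq)
  qed
qed

theorem theorem1p2:
  fixes g D :: nat
  assumes "g \<ge> 2" and "D \<ge> 1"
  shows "has_log_density {n. n > 1 \<and> leftmost_digits g D (aliquot_sum n)}
           (log (real g) (1 + 1 / real D))"
proof -
  \<comment> \<open>The windows \<open>[D, D + 1)\<close> and \<open>[D + 1, D * g)\<close> together
    fill one full period \<open>[D, D * g)\<close> of the scale, so their logarithmic lengths add up
    to 1.\<close>
  define A where "A = (\<lambda>a b. {n. \<exists>j::nat. a * real g ^ j \<le> real (aliquot_sum n) \<and> real (aliquot_sum n) < b * real g ^ j})"
  \<comment> \<open>Keeps the first window within one period and the second one well-formed.\<close>
  have "D + 1 \<le> D * 2" using assms by simp
  also have "\<dots> \<le> D * g" using assms by simp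
  finally have Dg: "real D + 1 \<le> real D * real g"
    by (metis of_nat_1 of_nat_add of_nat_le_iff of_nat_mult)
  have digits: "{n. n > 1 \<and> leftmost_digits g D (aliquot_sum n)} = A (real D) (real D + 1)"
  proof -
    \<comment> \<open>The condition \<open>n > 1\<close> is automatic: s(0) = s(1) = 0, and 0 does
      not begin with the digits of a positive \<open>D\<close>.\<close>
    have "n > 1 \<and> leftmost_digits g D (aliquot_sum n) \<longleftrightarrow> leftmost_digits g D (aliquot_sum n)" for n
    proof -
      have "aliquot_sum n = 0" if "n \<le> 1"
      proof -
        have "n = 0 \<or> n = 1" using that by auto
        then show ?thesis by (auto simp: aliquot_sum_def)
      qed
      moreover have "\<not> leftmost_digits g D 0"
        using assms by (auto simp: leftmost_digits_def)
      ultimately show ?thesis by (metis not_le)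
    qed
    moreover have "leftmost_digits g D m \<longleftrightarrow>
        (\<exists>j. real D * real g ^ j \<le> real m \<and> real m < (real D + 1) * real g ^ j)" for m
    proof -
      have "real D * real g ^ j = real (D * g ^ j)"
        "(real D + 1) * real g ^ j = real ((D + 1) * g ^ j)" for j
        by (simp_all add: algebra_simps)
      then show ?thesis by (simp only: leftmost_digits_def of_nat_le_iff of_nat_less_iff)
    qed
    ultimately show ?thesis by (simp add: A_def)
  qed
  have disj: "A (real D) (real D + 1) \<inter> A (real D + 1) (real D * real g) = {}"
  proof -
    \<comment> \<open>Comparing the ends at \<open>D + 1\<close> gives \<open>j < i\<close>,
      comparing those at \<open>D\<close> gives \<open>i < j + 1\<close>.\<close>
    have False
      if "real D * real g ^ i \<le> s" "s < (real D + 1) * real g ^ i"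
        "(real D + 1) * real g ^ j \<le> s" "s < real D * real g * real g ^ j" for s :: real and i j
    proof -
      have "(real D + 1) * real g ^ j < (real D + 1) * real g ^ i"
        using that(2,3) by linarith
      then have "real g ^ j < real g ^ i"
        by (rule mult_left_less_imp_less) simp
      then have "j < i"
        by (rule power_less_imp_less_exp[rotated]) (use assms in simp)
      have "real D * real g ^ i < real D * real g ^ Suc j"
        using that(1,4) by (simp add: mult.assoc)
      then have "real g ^ i < real g ^ Suc j"
        by (rule mult_left_less_imp_less) simp
      then have "i < Suc j"
        by (rule power_less_imp_less_exp[rotated]) (use assms in simp)
      with \<open>j < i\<close> show False by simp
    qed
    then show ?thesis unfolding A_def by blast
  qed
  have "lower_log_density_ge (A (real D) (real D + 1)) (log (real g) ((real D + 1) / real D))"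
    unfolding A_def using assms Dg by (intro aliquot_sum_digits_lower_density) auto
  moreover have "(real D + 1) / real D = 1 + 1 / real D"
    using assms by (simp add: field_simps)
  ultimately have 1: "lower_log_density_ge (A (real D) (real D + 1)) (log (real g) (1 + 1 / real D))"
    by simp
  have "lower_log_density_ge (A (real D + 1) (real D * real g))
      (log (real g) (real D * real g / (real D + 1)))"
    unfolding A_def using assms Dg
    by (intro aliquot_sum_digits_lower_density) (auto simp: algebra_simps)
  moreover have "log (real g) (real D * real g / (real D + 1)) = 1 - log (real g) (1 + 1 / real D)"
  proof -
    have "real D * real g / (real D + 1) = real g / (1 + 1 / real D)"
      using assms by (simp add: field_simps)
    moreover have "1 + 1 / real D > 0" by (simp add: add_pos_nonneg)
    ultimately show ?thesis using assms by (simp add: log_divide)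
  qed
  ultimately have 2: "lower_log_density_ge (A (real D + 1) (real D * real g)) (1 - log (real g) (1 + 1 / real D))"
    by simp
  show ?thesis
    unfolding digits by (rule has_log_density_of_lower_densities[OF 1 2 disj])
qed

end
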